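(* Let $\mathbf{U}\subset\mathbb{R}^d$ be a ball of radius $r$, let $2\mathbf{U}$ be the concentric ball of radius $2r$, and let $\mathbf{f}=(f_1,\dots,f_n)\in C^2(2\mathbf{U})$ with values in $\mathbb{R}^n$. Let $$L^*:=\sup_{|\beta|=2,\ \mathbf{x}\in 2\mathbf{U}}\|\partial_\beta\mathbf{f}(\mathbf{x})\|_\infty,\qquad L:=\max\left(L^*,\frac{1}{4r^2}\right).$$ Then for every $\delta'>0$ and every $\mathbf{q}\in\mathbb{Z}^n\setminus\{\mathbf{0}\}$, the set of $\mathbf{x}\in\mathbf{U}$ such that $\|\mathbf{f}(\mathbf{x})\cdot\mathbf{q}\|<\delta'$ and $$\|\nabla\mathbf{f}(\mathbf{x})\mathbf{q}\|_\infty\ge\sqrt{ndL\|\mathbf{q}\|_\infty}$$ has Lebesgue measure at most $K_d\delta'|\mathbf{U}|_d$, where $$K_d:=\frac{4^{2d+1}d^{d/2}N_d}{V_d}.$$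
   Context: $\partial_\beta$ denotes partial differentiation with multi-index $\beta\in\mathbb{N}_0^d$, $|\beta|=\beta_1+\dots+\beta_d$. $\|\cdot\|_\infty$ is the sup norm. For $x\in\mathbb{R}$, $\|x\|$ is the distance to the nearest integer. $\mathbf{f}(\mathbf{x})\cdot\mathbf{q}=\sum_i f_i(\mathbf{x})q_i$ and $\nabla\mathbf{f}(\mathbf{x})\mathbf{q}\in\mathbb{R}^d$ denotes the gradient of $\mathbf{x}\mapsto\mathbf{f}(\mathbf{x})\cdot\mathbf{q}$. $|\cdot|_d$ is $d$-dimensional Lebesgue measure. $V_d=\pi^{d/2}/\Gamma(1+d/2)$ is the volume of the unit ball in $\mathbb{R}^d$ and $N_d$ is the Besicovitch covering constant of $\mathbb{R}^d$. *)

theory Defs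
  imports "HOL-Analysis.Analysis"
begin

definition partial_deriv ::
    "'d::finite \<Rightarrow> (real ^ 'd \<Rightarrow> 'b::real_normed_vector) \<Rightarrow> real ^ 'd \<Rightarrow> 'b" where
  "partial_deriv i g x = vector_derivative (\<lambda>t. g (x + t *\<^sub>R axis i 1)) (at 0)"

text \<open>
  The partial derivative with multi-index \<open>\<beta>\<close>. The index type carries no order, so the order in
  which the coordinates are differentiated is an arbitrary enumeration of \<open>\<beta>\<close>; by the symmetry of
  mixed partial derivatives it does not matter for functions of class \<open>C\<^sup>k\<close> with \<open>k \<ge> |\<beta>|\<close>
  on an open set.
\<close>

definition multi_partial_deriv ::
    "nat ^ 'd::finite \<Rightarrow> (real ^ 'd \<Rightarrow> 'b::real_normed_vector) \<Rightarrow> real ^ 'd \<Rightarrow> 'b" where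
  "multi_partial_deriv \<beta> g =
     foldr partial_deriv (SOME is. \<forall>i. count_list is i = \<beta> $ i) g"

definition multi_index_order :: "nat ^ 'd::finite \<Rightarrow> nat" where
  "multi_index_order \<beta> = (\<Sum>i\<in>UNIV. \<beta> $ i)"

text \<open>Class \<open>C\<^sup>k\<close> on \<open>S\<close>; only meant for open \<open>S\<close>.\<close>

primrec Ck_on ::
    "nat \<Rightarrow> (real ^ 'd::finite \<Rightarrow> 'b::real_normed_vector) \<Rightarrow> (real ^ 'd) set \<Rightarrow> bool" where
  "Ck_on 0 g S \<longleftrightarrow> continuous_on S g"
| "Ck_on (Suc k) g S \<longleftrightarrow> continuous_on S g \<and>
     (\<forall>i. (\<forall>x\<in>S. (\<lambda>t. g (x + t *\<^sub>R axis i 1)) differentiable (at 0)) \<and>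
          Ck_on k (partial_deriv i g) S)"

definition gradient :: "('a::real_inner \<Rightarrow> real) \<Rightarrow> 'a \<Rightarrow> 'a" where
  "gradient g x = (THE D. GDERIV g x :> D)"

definition dist_nearest_int :: "real \<Rightarrow> real" where
  "dist_nearest_int x = \<bar>x - of_int (round x)\<bar>"

text \<open>
  The second derivatives of a \<open>C\<^sup>2\<close> function on an open ball may be unbounded, so the supremum
  is taken in the extended reals.
\<close>

definition second_deriv_sup ::
    "(real ^ 'd::finite \<Rightarrow> real ^ 'n::finite) \<Rightarrow> (real ^ 'd) set \<Rightarrow> ereal" where
  "second_deriv_sup f S =
     (SUP \<beta>\<in>{\<beta>. multi_index_order \<beta> = 2}. SUP x\<in>S. ereal (infnorm (multi_partial_deriv \<beta> f x)))"

definition L_bound ::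
    "(real ^ 'd::finite \<Rightarrow> real ^ 'n::finite) \<Rightarrow> real ^ 'd \<Rightarrow> real \<Rightarrow> ereal" where
  "L_bound f c r = max (second_deriv_sup f (ball c (2 * r))) (ereal (1 / (4 * r\<^sup>2)))"

text \<open>Square root on the nonnegative extended reals.\<close>

definition ereal_sqrt :: "ereal \<Rightarrow> ereal" where
  "ereal_sqrt a = (if a = \<infinity> then \<infinity> else ereal (sqrt (real_of_ereal a)))"

text \<open>
  \<open>besicovitch_bound TYPE('a) N\<close>: whenever every point of a bounded set \<open>S\<close> is the centre of a
  ball of the family \<open>B\<close>, a countable subfamily of \<open>B\<close> covers \<open>S\<close> with multiplicity at most \<open>N\<close>.
  The Besicovitch covering theorem asserts that such an \<open>N\<close> exists for every Euclidean space; the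
  Besicovitch constant is the least one.
\<close>

definition besicovitch_bound :: "'a::euclidean_space itself \<Rightarrow> nat \<Rightarrow> bool" where
  "besicovitch_bound _ N \<longleftrightarrow>
     (\<forall>(S :: 'a set) B.
        bounded S \<and>
        (\<forall>A\<in>B. \<exists>c r. 0 < r \<and> A = ball c r) \<and>
        (\<forall>x\<in>S. \<exists>r>0. ball x r \<in> B) \<longrightarrow>
        (\<exists>C\<subseteq>B. countable C \<and> S \<subseteq> \<Union>C \<and>
           (\<forall>x. finite {A\<in>C. x \<in> A} \<and> card {A\<in>C. x \<in> A} \<le> N)))"

definition besicovitch_const :: "'a::euclidean_space itself \<Rightarrow> nat" where
  "besicovitch_const T = (LEAST N. besicovitch_bound T N)"

definition K_const :: "'d::finite itself \<Rightarrow> real" where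
  "K_const _ =
     4 ^ (2 * CARD('d) + 1) * real CARD('d) powr (real CARD('d) / 2)
       * real (besicovitch_const TYPE(real ^ 'd)) / unit_ball_vol (real CARD('d))"

end

theory Submission
  imports Defs
begin

text \<open>
  Write \<open>g x = f x \<bullet> q\<close> and let \<open>G\<close> be the sup norm of the gradient of \<open>g\<close> at a point \<open>x\<close> of the
  set. All second derivatives of \<open>g\<close> are at most \<open>n L \<parallel>q\<parallel> \<le> G\<^sup>2 / d\<close>, so on the ball of radius
  \<open>\<rho> = 1 / (8 d G) \<le> r\<close> about \<open>x\<close> the gradient hardly changes: \<open>g\<close> varies by less than \<open>1/4\<close>, hence
  (for \<open>\<delta> \<le> 1/4\<close>) only one integer can come within \<open>\<delta>\<close> of \<open>g\<close>, and along the coordinate in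
  which the gradient is largest \<open>g\<close> grows at rate at least \<open>G/2\<close>. Every line in that direction
  therefore meets the set in diameter at most \<open>4 \<delta> / G\<close>, and Fubini bounds the proportion of the
  ball that lies in the set by a multiple of \<open>\<delta>\<close>. The Besicovitch covering theorem adds these
  local bounds up. It has to be proved too, since the constant is defined as a least element and has
  no known value before the set of admissible constants is known to be nonempty.
\<close>

subsection \<open>The Besicovitch covering theorem\<close>

text \<open>By compactness finitely many balls of radius \<open>e/2\<close> cover the sphere, and
  each of them contains at most one point of an \<open>e\<close>-separated set.\<close>

lemma card_separated_sphere_bounded:
  fixes e :: real
  assumes "e > 0"
  obtains M where "\<And>F. \<lbrakk>finite F; F \<subseteq> sphere (0::'a::euclidean_space) 1;
      \<And>u v. \<lbrakk>u \<in> F; v \<in> F; u \<noteq> v\<rbrakk> \<Longrightarrow> e \<le> dist u v\<rbrakk> \<Longrightarrow> card F \<le> M"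
proof -
  obtain K where K: "finite K" "sphere (0::'a) 1 \<subseteq> (\<Union>x\<in>K. ball x (e/2))"
  proof (rule compactE_image[OF compact_sphere, of "sphere (0::'a) 1" "\<lambda>x. ball x (e/2)"])
    show "sphere (0::'a) 1 \<subseteq> (\<Union>x\<in>sphere 0 1. ball x (e/2))"
      using assms by force
  qed auto
  show ?thesis
  proof
    fix F :: "'a set"
    assume F: "finite F" "F \<subseteq> sphere 0 1"
      and sep: "\<And>u v. \<lbrakk>u \<in> F; v \<in> F; u \<noteq> v\<rbrakk> \<Longrightarrow> e \<le> dist u v"
    have "\<forall>u\<in>F. \<exists>x\<in>K. dist x u < e/2"
      using F K by (auto simp: subset_iff)
    then obtain k where k: "\<And>u. u \<in> F \<Longrightarrow> k u \<in> K" "\<And>u. u \<in> F \<Longrightarrow> dist (k u) u < e/2"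
      by metis
    have "inj_on k F"
    proof (rule inj_onI, rule ccontr)
      fix u v assume uv: "u \<in> F" "v \<in> F" "k u = k v" "u \<noteq> v"
      have "dist u v < e"
        using dist_triangle3[of u v "k u"] k(2)[OF uv(1)] k(2)[OF uv(2)] uv(3) by simp
      with sep[OF uv(1,2,4)] show False by simp
    qed
    then show "card F \<le> card K"
      using K k by (intro card_inj_on_le[of k]) auto
  qed
qed

text \<open>
  Here \<open>x\<close> is the point selected first. The ratio \<open>21/20\<close> is tuned to the cut-off \<open>1/10\<close> below: seen
  from a common point of the balls, the centres not within \<open>1/10\<close> of their radii lie in directions
  that are \<open>1/2\<close>-separated, and at most one centre is closer.
\<close>

definition greedy_pair :: "('a::metric_space \<Rightarrow> real) \<Rightarrow> 'a \<Rightarrow> 'a \<Rightarrow> bool" where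
  "greedy_pair \<rho> x y \<longleftrightarrow> \<rho> x \<le> dist x y \<and> \<rho> y \<le> 21/20 * \<rho> x"

definition greedy_family :: "('a::metric_space \<Rightarrow> real) \<Rightarrow> 'a set \<Rightarrow> bool" where
  "greedy_family \<rho> T \<longleftrightarrow> (\<forall>x\<in>T. \<rho> x > 0) \<and>
     (\<forall>x\<in>T. \<forall>y\<in>T. x \<noteq> y \<longrightarrow> greedy_pair \<rho> x y \<or> greedy_pair \<rho> y x)"

text \<open>With \<open>x\<close> the centre nearer to \<open>p\<close>, the triangle inequality
  gives \<open>dist x y \<le> a * dist u v + (b - a)\<close>, while the greedy conditions force
  \<open>dist x y \<ge> b - a / 2\<close>. Comparing the two leaves
  \<open>dist u v \<ge> 1/2\<close>.\<close>

lemma greedy_directions_separated_le: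
  fixes x y p :: "'a::real_inner"
  assumes g: "greedy_pair \<rho> x y \<or> greedy_pair \<rho> y x"
    and x: "dist x p < \<rho> x" "\<rho> x / 10 \<le> dist x p" and y: "dist y p < \<rho> y"
    and le: "dist x p \<le> dist y p" and pos: "\<rho> x > 0"
  shows "1/2 \<le> dist (sgn (x - p)) (sgn (y - p))"
proof -
  define a where "a = dist x p"
  define b where "b = dist y p"
  define u where "u = sgn (x - p)"
  define v where "v = sgn (y - p)"
  have a: "a > 0" using x(2) pos unfolding a_def by linarith
  have b: "b \<ge> a" using le by (simp add: a_def b_def)
  have "x \<noteq> p" "y \<noteq> p" using a b by (auto simp: a_def b_def)
  then have xu: "x - p = a *\<^sub>R u" and yv: "y - p = b *\<^sub>R v"
    by (simp_all add: a_def b_def u_def v_def sgn_div_norm dist_norm)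
  have nv: "norm v = 1" using \<open>y \<noteq> p\<close> by (simp add: v_def norm_sgn)
  have "x - y = a *\<^sub>R (u - v) - (b - a) *\<^sub>R v"
    using xu yv by (simp add: algebra_simps diff_eq_eq)
  then have "dist x y \<le> a * dist u v + (b - a)"
    using norm_triangle_ineq4[of "a *\<^sub>R (u - v)" "(b - a) *\<^sub>R v"] a b nv
    by (simp add: dist_norm)
  moreover have "b - a / 2 \<le> dist x y"
    using g
  proof
    assume "greedy_pair \<rho> x y"
    then have "\<rho> x \<le> dist x y" "\<rho> y \<le> 21/20 * \<rho> x" by (auto simp: greedy_pair_def)
    \<comment> \<open>Here \<open>b\<close> exceeds \<open>\<rho> x\<close> by less than
      \<open>\<rho> x / 20\<close>, and the cut-off \<open>\<rho> x / 10 \<le> a\<close> turns this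
      into at most \<open>a / 2\<close>.\<close>
    then show ?thesis using x(2) y unfolding a_def b_def by linarith
  next
    assume "greedy_pair \<rho> y x"
    then have "\<rho> y \<le> dist x y" by (auto simp: greedy_pair_def dist_commute)
    then show ?thesis using y a unfolding b_def by linarith
  qed
  ultimately have "a * (1/2) \<le> a * dist u v" by linarith
  then show ?thesis using a by (simp add: u_def v_def)
qed

lemma greedy_directions_separated:
  fixes x y p :: "'a::real_inner"
  assumes "greedy_pair \<rho> x y \<or> greedy_pair \<rho> y x"
    and "dist x p < \<rho> x" "\<rho> x / 10 \<le> dist x p" "dist y p < \<rho> y" "\<rho> y / 10 \<le> dist y p"
    and "\<rho> x > 0" "\<rho> y > 0"
  shows "1/2 \<le> dist (sgn (x - p)) (sgn (y - p))"
  using greedy_directions_separated_le[of \<rho> x y p] greedy_directions_separated_le[of \<rho> y x p] assms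
  by (cases "dist x p \<le> dist y p") (auto simp: dist_commute)

text \<open>Two centres within a tenth of their radii of \<open>p\<close> would be closer together
  than a greedy pair allows in either order, so there is at most one. The remaining centres give
  \<open>1/2\<close>-separated directions on the unit sphere. The bound depends on the space
  only.\<close>

lemma greedy_multiplicity_bounded:
  "\<exists>N. \<forall>\<rho> T p. greedy_family \<rho> T \<longrightarrow>
     finite {x\<in>T. dist x p < \<rho> x} \<and> card {x\<in>T. dist x (p::'a::euclidean_space) < \<rho> x} \<le> N"
proof -
  obtain M where M: "\<And>F. \<lbrakk>finite F; F \<subseteq> sphere (0::'a) 1;
      \<And>u v. \<lbrakk>u \<in> F; v \<in> F; u \<noteq> v\<rbrakk> \<Longrightarrow> 1/2 \<le> dist u v\<rbrakk> \<Longrightarrow> card F \<le> M"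
    using card_separated_sphere_bounded[of "1/2"] by (metis half_gt_zero zero_less_one)
  show ?thesis
  proof (intro exI[of _ "Suc M"] allI impI)
    fix \<rho> and T :: "'a set" and p :: 'a
    assume fam: "greedy_family \<rho> T"
    have pos: "\<rho> x > 0" if "x \<in> T" for x
      using fam that by (simp add: greedy_family_def)
    have gr: "greedy_pair \<rho> x y \<or> greedy_pair \<rho> y x" if "x \<in> T" "y \<in> T" "x \<noteq> y" for x y
      using fam that by (simp add: greedy_family_def)
    let ?X = "{x\<in>T. dist x p < \<rho> x}"
    \<comment> \<open>Finite subsets come first: a common bound on their size also yields finiteness
      of the whole set.\<close>
    have fin_bound: "card F \<le> Suc M" if F: "finite F" "F \<subseteq> ?X" for F
    proof -
      define Near where "Near = {x\<in>F. dist x p < \<rho> x / 10}"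
      define Far where "Far = {x\<in>F. \<rho> x / 10 \<le> dist x p}"
      have "x = y" if "x \<in> Near" "y \<in> Near" for x y
      proof (rule ccontr)
        assume "x \<noteq> y"
        moreover have "x \<in> T" "y \<in> T" using that F by (auto simp: Near_def)
        ultimately have "greedy_pair \<rho> x y \<or> greedy_pair \<rho> y x" "\<rho> x > 0" "\<rho> y > 0"
          using gr pos by auto
        moreover have "dist x y \<le> dist x p + dist y p" by (rule dist_triangle2)
        moreover have "dist x p < \<rho> x / 10" "dist y p < \<rho> y / 10"
          using that by (auto simp: Near_def)
        ultimately show False
          unfolding greedy_pair_def dist_commute[of y x] by linarith
      qed
      then have near: "card Near \<le> 1"
        using F by (auto simp: card_le_Suc0_iff_eq Near_def)
      let ?u = "\<lambda>x. sgn (x - p)"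
      have sep: "1/2 \<le> dist (?u x) (?u y)" if "x \<in> Far" "y \<in> Far" "x \<noteq> y" for x y
        using that F gr[of x y] pos[of x] pos[of y]
        by (intro greedy_directions_separated[of \<rho>]) (auto simp: Far_def)
      then have "inj_on ?u Far" by (intro inj_onI) (metis dist_self not_one_le_zero half_gt_zero_iff not_less zero_less_one)
      then have "card Far = card (?u ` Far)" by (simp add: card_image)
      also have "\<dots> \<le> M"
      proof (rule M)
        show "?u ` Far \<subseteq> sphere 0 1"
          using F pos by (fastforce simp: Far_def norm_sgn)
      qed (use F sep in \<open>auto simp: Far_def\<close>)
      finally have "card Far \<le> M" .
      moreover have "F = Near \<union> Far" by (auto simp: Near_def Far_def)
      ultimately show ?thesis using near card_Un_le[of Near Far] by simp
    qed
    have "finite ?X"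
    proof (rule ccontr)
      assume "infinite ?X"
      then obtain F where "F \<subseteq> ?X" "finite F" "card F = Suc (Suc M)"
        using infinite_arbitrarily_large by blast
      with fin_bound[of F] show False by simp
    qed
    with fin_bound show "finite ?X \<and> card ?X \<le> Suc M" by blast
  qed
qed

text \<open>
  Points are processed by decreasing size class of their radii; within a size class the order is an
  arbitrary well-order, since there the radii are comparable up to the factor \<open>21/20\<close>.
\<close>

lemma greedy_selection:
  fixes S :: "'a::metric_space set"
  assumes pos: "\<And>x. x \<in> S \<Longrightarrow> \<rho> x > 0" and bd: "\<And>x. x \<in> S \<Longrightarrow> \<rho> x \<le> M"
  obtains T where "T \<subseteq> S" "S \<subseteq> (\<Union>x\<in>T. ball x (\<rho> x))" "greedy_family \<rho> T"
proof -
  \<comment> \<open>Level \<open>k\<close> collects the radii in the half-open interval from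
    \<open>M * (20/21)^(k+1)\<close>, excluded, to \<open>M * (20/21)^k\<close>, included. On
    \<open>S\<close> the logarithm is nonnegative, so \<open>nat\<close> truncates nothing.\<close>
  define lev where "lev x = nat \<lfloor>log (21/20) (M / \<rho> x)\<rfloor>" for x
  have lev: "\<rho> y \<le> 21/20 * \<rho> x" if "x \<in> S" "y \<in> S" "lev x \<le> lev y" for x y
  proof -
    have "M > 0" using pos[OF that(1)] bd[OF that(1)] by linarith
    have nonneg: "log (21/20) (M / \<rho> z) \<ge> 0" if "z \<in> S" for z
      using pos[OF that] bd[OF that] by (simp add: zero_le_log_cancel_iff)
    have "log (21/20) (M / \<rho> x) \<le> log (21/20) (M / \<rho> y) + 1"
      using that nonneg[OF that(1)] nonneg[OF that(2)] unfolding lev_def by linarith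
    also have "\<dots> = log (21/20) (21/20 * (M / \<rho> y))"
      using \<open>M > 0\<close> pos[OF that(2)] by (subst log_mult) auto
    finally have "M / \<rho> x \<le> 21/20 * (M / \<rho> y)"
      using \<open>M > 0\<close> pos[OF that(2)] pos[OF that(1)] by (subst (asm) log_le_cancel_iff) auto
    then show ?thesis using \<open>M > 0\<close> pos[OF that(2)] pos[OF that(1)] by (simp add: field_simps)
  qed
  obtain w :: "'a rel" where w: "Well_order w" "Field w = UNIV" by (metis well_ordering)
  define R where "R = lev <*mlex*> (w - Id)"
  have wfR: "wf R" using w unfolding R_def well_order_on_def by (intro wf_mlex) blast
  have total: "(x, y) \<in> R \<or> (y, x) \<in> R" if "x \<noteq> y" for x y
  proof -
    have "(x, y) \<in> w \<or> (y, x) \<in> w"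
      using w that unfolding well_order_on_def linear_order_on_def total_on_def by simp
    then show ?thesis using that unfolding R_def mlex_iff by auto
  qed
  have R_lev: "lev x \<le> lev y" if "(x, y) \<in> R" for x y
    using that by (auto simp: R_def mlex_iff)
  \<comment> \<open>Transfinite greedy choice: a point of \<open>S\<close> is selected exactly when
    it lies in no ball around an earlier selected point. So unselected points are covered, and of
    two selected points the later one lies outside the ball of the earlier one.\<close>
  define P where "P = wfrec R (\<lambda>P x. x \<in> S \<and> (\<forall>y. (y, x) \<in> R \<longrightarrow> P y \<longrightarrow> \<rho> y \<le> dist y x))"
  have P: "P x \<longleftrightarrow> x \<in> S \<and> (\<forall>y. (y, x) \<in> R \<longrightarrow> P y \<longrightarrow> \<rho> y \<le> dist y x)" for x
    using wfrec[OF wfR, of "\<lambda>P x. x \<in> S \<and> (\<forall>y. (y, x) \<in> R \<longrightarrow> P y \<longrightarrow> \<rho> y \<le> dist y x)" x]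
    unfolding P_def[symmetric] by (simp add: cut_apply cong: imp_cong)
  show ?thesis
  proof (rule that[of "Collect P"])
    show "Collect P \<subseteq> S" using P by blast
    show "S \<subseteq> (\<Union>x\<in>Collect P. ball x (\<rho> x))"
    proof
      fix x assume "x \<in> S"
      show "x \<in> (\<Union>x\<in>Collect P. ball x (\<rho> x))"
      proof (cases "P x")
        case True
        then show ?thesis using pos[OF \<open>x \<in> S\<close>] by force
      next
        case False
        then obtain y where "P y" "\<not> \<rho> y \<le> dist y x" using \<open>x \<in> S\<close> P by metis
        then show ?thesis by auto
      qed
    qed
    have "greedy_pair \<rho> x y \<or> greedy_pair \<rho> y x" if "P x" "P y" "x \<noteq> y" for x y
      using that total[of x y] P lev R_lev unfolding greedy_pair_def by metis
    moreover have "\<rho> x > 0" if "P x" for x using that P pos by blast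
    ultimately show "greedy_family \<rho> (Collect P)" by (simp add: greedy_family_def)
  qed
qed

text \<open>Each nonempty member contains a point of a countable dense set, and each such point lies
  in finitely many members.\<close>

lemma countable_open_bounded_multiplicity:
  fixes C :: "'a::second_countable_topology set set"
  assumes op: "\<And>A. A \<in> C \<Longrightarrow> open A" and fin: "\<And>x. finite {A\<in>C. x \<in> A}"
  shows "countable C"
proof -
  obtain D :: "'a set" where D: "countable D" "\<And>X. \<lbrakk>open X; X \<noteq> {}\<rbrakk> \<Longrightarrow> \<exists>d\<in>D. d \<in> X"
    using countable_dense_setE by metis
  have "C \<subseteq> insert {} (\<Union>d\<in>D. {A\<in>C. d \<in> A})" using op D(2) by fastforce
  moreover have "countable \<dots>" using D(1) fin by (auto intro: countable_finite)
  ultimately show ?thesis by (rule countable_subset)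
qed

text \<open>Greedy selection needs bounded radii. If some radius exceeds the diameter of
  \<open>S\<close>, that ball alone covers \<open>S\<close>; otherwise the diameter bounds all
  radii.\<close>

theorem besicovitch_bound_exists: "\<exists>N. besicovitch_bound TYPE('a::euclidean_space) N"
proof -
  obtain N where N: "\<And>\<rho> T p. greedy_family \<rho> T \<Longrightarrow>
      finite {x\<in>T. dist x p < \<rho> x} \<and> card {x\<in>T. dist x (p::'a) < \<rho> x} \<le> N"
    using greedy_multiplicity_bounded by blast
  \<comment> \<open>The successor makes the bound at least 1, as the case of a single ball
    requires.\<close>
  have "besicovitch_bound TYPE('a) (Suc N)"
    unfolding besicovitch_bound_def
  proof (intro allI impI, elim conjE)
    fix S :: "'a set" and B
    assume bS: "bounded S" and cov: "\<forall>x\<in>S. \<exists>r>0. ball x r \<in> B"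
    obtain \<rho> where \<rho>: "\<And>x. x \<in> S \<Longrightarrow> \<rho> x > 0" "\<And>x. x \<in> S \<Longrightarrow> ball x (\<rho> x) \<in> B"
      using cov by metis
    show "\<exists>C\<subseteq>B. countable C \<and> S \<subseteq> \<Union>C \<and>
        (\<forall>x. finite {A\<in>C. x \<in> A} \<and> card {A\<in>C. x \<in> A} \<le> Suc N)"
    proof (cases "\<exists>x\<in>S. diameter S < \<rho> x")
      case True
      then obtain x where x: "x \<in> S" "diameter S < \<rho> x" by blast
      have "S \<subseteq> ball x (\<rho> x)"
        using diameter_bounded_bound[OF bS x(1)] x(2) by force
      moreover have "card {A \<in> {ball x (\<rho> x)}. y \<in> A} \<le> Suc N" for y
        by (rule le_trans[OF card_mono[of "{ball x (\<rho> x)}"]]) auto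
      ultimately show ?thesis using \<rho>(2)[OF x(1)]
        by (intro exI[of _ "{ball x (\<rho> x)}"]) (auto intro: le_SucI)
    next
      case False
      obtain T where T: "T \<subseteq> S" "S \<subseteq> (\<Union>x\<in>T. ball x (\<rho> x))" "greedy_family \<rho> T"
      proof (rule greedy_selection[of S \<rho> "diameter S"])
        show "\<rho> x \<le> diameter S" if "x \<in> S" for x using False that by force
      qed (use \<rho>(1) in auto)
      define C where "C = (\<lambda>x. ball x (\<rho> x)) ` T"
      have mult: "finite {A\<in>C. p \<in> A} \<and> card {A\<in>C. p \<in> A} \<le> N" for p
      proof -
        have eq: "{A\<in>C. p \<in> A} = (\<lambda>x. ball x (\<rho> x)) ` {x\<in>T. dist x p < \<rho> x}"
          by (auto simp: C_def)
        have "finite {x\<in>T. dist x p < \<rho> x} \<and> card {x\<in>T. dist x p < \<rho> x} \<le> N"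
          using T(3) by (rule N)
        then show ?thesis unfolding eq using card_image_le le_trans by blast
      qed
      have "countable C"
        using mult by (intro countable_open_bounded_multiplicity) (auto simp: C_def)
      then show ?thesis using T \<rho> mult
        by (intro exI[of _ C]) (auto simp: C_def intro: le_SucI)
    qed
  qed
  then show ?thesis ..
qed

lemma besicovitch_bound_const: "besicovitch_bound TYPE('a::euclidean_space) (besicovitch_const TYPE('a))"
  unfolding besicovitch_const_def using besicovitch_bound_exists by (rule LeastI_ex)

text \<open>Covering a one-point set already takes a ball through that point.\<close>

lemma besicovitch_const_pos: "besicovitch_const TYPE('a::euclidean_space) > 0"
proof -
  have "\<exists>C\<subseteq>{ball (0::'a) 1}. countable C \<and> {0} \<subseteq> \<Union>C \<and>
      (\<forall>x. finite {A\<in>C. x \<in> A} \<and> card {A\<in>C. x \<in> A} \<le> besicovitch_const TYPE('a))"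
    by (rule besicovitch_bound_const[unfolded besicovitch_bound_def, rule_format])
      (auto intro!: exI[of _ "0::'a"] exI[of _ "1::real"])
  then obtain C where C: "{0} \<subseteq> \<Union>C" "finite {A\<in>C. (0::'a) \<in> A}"
    "card {A\<in>C. (0::'a) \<in> A} \<le> besicovitch_const TYPE('a)" by blast
  then have "card {A\<in>C. (0::'a) \<in> A} > 0" by (auto simp: card_gt_0_iff)
  with C show ?thesis by linarith
qed

subsection \<open>Partial derivatives\<close>

text \<open>Differentiability along coordinate lines only, as \<open>Ck_on\<close> supplies it. The
  partials are a parameter, so the notion can be applied again to each \<open>D i\<close>.\<close>

definition has_partials :: "(real ^ 'd::finite \<Rightarrow> real) \<Rightarrow> ('d \<Rightarrow> real ^ 'd \<Rightarrow> real) \<Rightarrow> (real ^ 'd) set \<Rightarrow> bool"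
  where "has_partials g D S \<longleftrightarrow>
    (\<forall>i. \<forall>x\<in>S. ((\<lambda>t. g (x + t *\<^sub>R axis i 1)) has_real_derivative D i x) (at 0))"

lemma has_partials_subset: "has_partials g D S \<Longrightarrow> T \<subseteq> S \<Longrightarrow> has_partials g D T"
  by (auto simp: has_partials_def)

lemma has_partials_line:
  assumes "has_partials g D S" and "y + s *\<^sub>R axis i 1 \<in> S"
  shows "((\<lambda>t. g (y + t *\<^sub>R axis i 1)) has_real_derivative D i (y + s *\<^sub>R axis i 1)) (at s)"
proof -
  have "((\<lambda>t. g (y + s *\<^sub>R axis i 1 + t *\<^sub>R axis i 1)) has_real_derivative D i (y + s *\<^sub>R axis i 1)) (at 0)"
    using assms by (simp add: has_partials_def)
  then show ?thesis
    using DERIV_shift[of "\<lambda>t. g (y + t *\<^sub>R axis i 1)" "D i (y + s *\<^sub>R axis i 1)" 0 s]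
    by (simp add: algebra_simps scaleR_add_left)
qed

text \<open>Mean value inequality along the segment for \<open>g\<close> minus a linear function of
  slope \<open>a\<close>.\<close>

lemma coordinate_increment:
  assumes "has_partials g D S"
    and "\<And>s. s \<in> closed_segment 0 t \<Longrightarrow> y + s *\<^sub>R axis i 1 \<in> S"
    and "\<And>s. s \<in> closed_segment 0 t \<Longrightarrow> \<bar>D i (y + s *\<^sub>R axis i 1) - a\<bar> \<le> e"
  shows "\<bar>g (y + t *\<^sub>R axis i 1) - g y - t * a\<bar> \<le> e * \<bar>t\<bar>"
proof -
  let ?\<phi> = "\<lambda>s. g (y + s *\<^sub>R axis i 1) - s * a"
  have "norm (?\<phi> t - ?\<phi> 0) \<le> e * norm (t - 0)"
  proof (rule field_differentiable_bound[of "closed_segment 0 t"])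
    show "(?\<phi> has_field_derivative D i (y + s *\<^sub>R axis i 1) - a) (at s within closed_segment 0 t)"
      if "s \<in> closed_segment 0 t" for s
      using DERIV_diff[OF has_partials_line[OF assms(1) assms(2)[OF that]] DERIV_cmult_right[OF DERIV_ident, of a]]
      unfolding mult_1_left by (rule has_field_derivative_at_within)
    show "norm (D i (y + s *\<^sub>R axis i 1) - a) \<le> e" if "s \<in> closed_segment 0 t" for s
      using assms(3)[OF that] by simp
  qed auto
  then show ?thesis by simp
qed

text \<open>The path from \<open>x\<close> to \<open>x + h\<close> changes one coordinate at a time.
  Its displacements from \<open>x\<close> are componentwise dominated by \<open>h\<close>, so it
  stays in the ball. Taking for \<open>a\<close> the partials at \<open>x\<close> leads to
  differentiability, taking \<open>a = 0\<close> gives Lipschitz bounds.\<close>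

lemma increment_bound:
  fixes g :: "real ^ 'd::finite \<Rightarrow> real"
  assumes part: "has_partials g D (ball x R)"
    and bound: "\<And>i y. y \<in> ball x R \<Longrightarrow> \<bar>D i y - a i\<bar> \<le> e"
    and h: "norm h < R"
  shows "\<bar>g (x + h) - g x - (\<Sum>i\<in>UNIV. h $ i * a i)\<bar> \<le> e * (\<Sum>i\<in>UNIV. \<bar>h $ i\<bar>)"
proof -
  define trunc where "trunc I = (\<chi> i. if i \<in> I then h $ i else 0)" for I
  have "\<bar>g (x + trunc I) - g x - (\<Sum>i\<in>I. h $ i * a i)\<bar> \<le> e * (\<Sum>i\<in>I. \<bar>h $ i\<bar>)" for I
  proof (induction I rule: finite_induct[OF finite])
    case 1
    have "trunc {} = 0" by (simp add: trunc_def vec_eq_iff)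
    then show ?case by simp
  next
    case (2 j I)
    have in_ball: "x + trunc I + s *\<^sub>R axis j 1 \<in> ball x R" if "s \<in> closed_segment 0 (h $ j)" for s
    proof -
      have "\<bar>s\<bar> \<le> \<bar>h $ j\<bar>" using that by (auto simp: closed_segment_eq_real_ivl split: if_splits)
      then have "norm (trunc I + s *\<^sub>R axis j 1) \<le> norm h"
        using 2(2) by (intro norm_le_componentwise_cart) (auto simp: trunc_def axis_def)
      moreover have "dist x (x + trunc I + s *\<^sub>R axis j 1) = norm (trunc I + s *\<^sub>R axis j 1)"
        by (simp only: dist_norm norm_minus_commute[of x] add.assoc add_diff_cancel_left')
      ultimately show ?thesis using h by simp
    qed
    have "trunc (insert j I) = trunc I + (h $ j) *\<^sub>R axis j 1"
      using 2(2) by (auto simp: trunc_def axis_def vec_eq_iff)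
    then have "\<bar>g (x + trunc (insert j I)) - g (x + trunc I) - h $ j * a j\<bar> \<le> e * \<bar>h $ j\<bar>"
      using coordinate_increment[OF part, of "h $ j" "x + trunc I" j "a j" e] in_ball bound
      by (simp add: add.assoc)
    with 2 show ?case by (simp add: algebra_simps)
  qed
  from this[of UNIV] show ?thesis by (simp add: trunc_def)
qed

lemma sum_abs_components_le: "(\<Sum>i\<in>UNIV. \<bar>h $ i\<bar>) \<le> real CARD('d) * norm (h :: real ^ 'd::finite)"
  by (rule sum_bounded_above) (rule component_le_norm_cart)

text \<open>On a small ball all partials are within \<open>e / d\<close> of their values at
  \<open>x\<close>, where \<open>d\<close> is the dimension; the sum of the \<open>d\<close>
  coordinate errors is then at most \<open>e * norm (y - x)\<close>.\<close>

lemma continuous_partials_imp_GDERIV: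
  fixes g :: "real ^ 'd::finite \<Rightarrow> real"
  assumes S: "open S" "x \<in> S" and part: "has_partials g D S"
    and cont: "\<And>i. continuous_on S (D i)"
  shows "GDERIV g x :> (\<chi> i. D i x)"
  unfolding gderiv_def has_derivative_at_alt
proof (intro conjI allI impI)
  show "bounded_linear (\<lambda>h. h \<bullet> (\<chi> i. D i x))" by (rule bounded_linear_inner_left)
  fix e :: real assume "e > 0"
  define e' where "e' = e / real CARD('d)"
  have e': "e' > 0" using \<open>e > 0\<close> by (simp add: e'_def)
  have "\<forall>\<^sub>F y in nhds x. dist (D i y) (D i x) < e'" for i
  proof -
    have "isCont (D i) x" using S cont[of i] by (simp add: continuous_on_eq_continuous_at)
    then show ?thesis
      using e' by (auto simp: isCont_def tendsto_at_iff_tendsto_nhds intro: tendstoD)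
  qed
  then have "\<forall>\<^sub>F y in nhds x. (\<forall>i. dist (D i y) (D i x) < e') \<and> y \<in> S"
    using S by (intro eventually_conj eventually_all_finite eventually_nhds_in_open)
  then obtain R where R: "R > 0" "\<And>y. dist y x < R \<Longrightarrow> (\<forall>i. dist (D i y) (D i x) < e') \<and> y \<in> S"
    by (auto simp: eventually_nhds_metric)
  have partR: "has_partials g D (ball x R)"
    using R by (intro has_partials_subset[OF part]) (auto simp: dist_commute)
  show "\<exists>R>0. \<forall>y. norm (y - x) < R \<longrightarrow>
      norm (g y - g x - (y - x) \<bullet> (\<chi> i. D i x)) \<le> e * norm (y - x)"
  proof (intro exI conjI allI impI)
    fix y assume "norm (y - x) < R"
    then have "\<bar>g (x + (y - x)) - g x - (\<Sum>i\<in>UNIV. (y - x) $ i * D i x)\<bar> \<le> e' * (\<Sum>i\<in>UNIV. \<bar>(y - x) $ i\<bar>)"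
      using R by (intro increment_bound[OF partR]) (auto simp: dist_commute dist_real_def intro: less_imp_le)
    also have "\<dots> \<le> e' * (real CARD('d) * norm (y - x))"
      using e' by (intro mult_left_mono sum_abs_components_le) auto
    also have "\<dots> = e * norm (y - x)" by (simp add: e'_def)
    finally show "norm (g y - g x - (y - x) \<bullet> (\<chi> i. D i x)) \<le> e * norm (y - x)"
      by (simp add: inner_vec_def)
  qed (rule R(1))
qed

lemma gradient_eq:
  assumes "GDERIV g x :> D"
  shows "gradient g x = D"
  unfolding gradient_def
proof (rule the_equality)
  fix D' assume "GDERIV g x :> D'"
  then have "(\<lambda>h. h \<bullet> D') = (\<lambda>h. h \<bullet> D)"
    using assms unfolding gderiv_def by (rule has_derivative_unique)
  then show "D' = D" by (metis vector_eq_ldot)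
qed (rule assms)

text \<open>Two applications of the mean value theorem: first in direction \<open>i\<close> to the
  difference of \<open>g\<close> on two parallel segments, then in direction \<open>j\<close> to
  \<open>D i\<close>.\<close>

lemma second_difference_mean_value:
  fixes g :: "real ^ 'd::finite \<Rightarrow> real"
  assumes part: "has_partials g D (ball x R)" and part2: "has_partials (D i) (H i) (ball x R)"
    and h: "0 < h" "2 * h < R"
  shows "\<exists>p\<in>ball x R. g (x + h *\<^sub>R axis i 1 + h *\<^sub>R axis j 1) - g (x + h *\<^sub>R axis i 1)
      - g (x + h *\<^sub>R axis j 1) + g x = h\<^sup>2 * H i j p"
proof -
  let ?a = "\<lambda>s. s *\<^sub>R axis i (1::real)" and ?b = "\<lambda>s. s *\<^sub>R axis j (1::real)"
  have in_ball: "x + ?a s + ?b t \<in> ball x R" if "0 \<le> s" "s \<le> h" "0 \<le> t" "t \<le> h" for s t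
  proof -
    have "norm (?a s + ?b t) \<le> \<bar>s\<bar> + \<bar>t\<bar>"
      using norm_triangle_ineq[of "?a s" "?b t"] by simp
    moreover have "dist x (x + ?a s + ?b t) = norm (?a s + ?b t)"
      by (simp only: dist_norm norm_minus_commute[of x] add.assoc add_diff_cancel_left')
    ultimately show ?thesis using that h by simp
  qed
  have "\<exists>s>0. s < h \<and> (g (x + ?b h + ?a h) - g (x + ?a h)) - (g (x + ?b h + ?a 0) - g (x + ?a 0)) =
      (h - 0) * (D i (x + ?b h + ?a s) - D i (x + ?a s))"
  proof (intro MVT2 h DERIV_diff has_partials_line[OF part])
    fix s assume "0 \<le> s" "s \<le> h"
    then show "x + ?b h + ?a s \<in> ball x R" "x + ?a s \<in> ball x R"
      using in_ball[of s h] in_ball[of s 0] h by (simp_all add: ac_simps)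
  qed
  then obtain s where s: "0 < s" "s < h"
    and eq: "g (x + ?a h + ?b h) - g (x + ?a h) - g (x + ?b h) + g x =
      h * (D i (x + ?a s + ?b h) - D i (x + ?a s))"
    by (auto simp: ac_simps algebra_simps)
  have "\<exists>t>0. t < h \<and> D i (x + ?a s + ?b h) - D i (x + ?a s + ?b 0) =
      (h - 0) * H i j (x + ?a s + ?b t)"
    using s in_ball[of s] by (intro MVT2 h has_partials_line[OF part2]) auto
  then obtain t where t: "0 < t" "t < h"
    and eq2: "D i (x + ?a s + ?b h) - D i (x + ?a s) = h * H i j (x + ?a s + ?b t)"
    by auto
  show ?thesis
    using in_ball[of s t] s t eq unfolding eq2 by (intro bexI[of _ "x + ?a s + ?b t"]) (auto simp: power2_eq_square)
qed

text \<open>The second difference is symmetric in \<open>i\<close> and \<open>j\<close>, so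
  \<open>H i j\<close> and \<open>H j i\<close> agree at two points near \<open>x\<close>;
  continuity carries this to \<open>x\<close>. Symmetry is what makes the order of differentiation
  chosen in \<open>multi_partial_deriv\<close> harmless.\<close>

lemma mixed_partials_symmetric:
  fixes g :: "real ^ 'd::finite \<Rightarrow> real"
  assumes S: "open S" "x \<in> S" and part: "has_partials g D S"
    and part2: "\<And>i. has_partials (D i) (H i) S"
    and cont: "\<And>i j. continuous_on S (H i j)"
  shows "H i j x = H j i x"
proof (rule ccontr)
  assume "H i j x \<noteq> H j i x"
  define e where "e = dist (H i j x) (H j i x) / 2"
  have e: "e > 0" using \<open>H i j x \<noteq> H j i x\<close> by (simp add: e_def)
  have "\<forall>\<^sub>F y in nhds x. dist (H k l y) (H k l x) < e" for k l
  proof -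
    have "isCont (H k l) x" using S cont by (simp add: continuous_on_eq_continuous_at)
    then show ?thesis
      using e by (auto simp: isCont_def tendsto_at_iff_tendsto_nhds intro: tendstoD)
  qed
  then have "\<forall>\<^sub>F y in nhds x. dist (H i j y) (H i j x) < e \<and> dist (H j i y) (H j i x) < e \<and> y \<in> S"
    using S by (intro eventually_conj eventually_nhds_in_open)
  then obtain R where R: "R > 0"
    "\<And>y. dist y x < R \<Longrightarrow> dist (H i j y) (H i j x) < e \<and> dist (H j i y) (H j i x) < e \<and> y \<in> S"
    by (auto simp: eventually_nhds_metric)
  have sub: "ball x R \<subseteq> S" using R by (auto simp: dist_commute)
  define h where "h = R / 3"
  have h: "0 < h" "2 * h < R" using R(1) by (auto simp: h_def)
  note mv = second_difference_mean_value[where D = D and H = H,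
      OF has_partials_subset[OF part sub] has_partials_subset[OF part2 sub] h]
  obtain p where p: "p \<in> ball x R" "g (x + h *\<^sub>R axis i 1 + h *\<^sub>R axis j 1) - g (x + h *\<^sub>R axis i 1)
      - g (x + h *\<^sub>R axis j 1) + g x = h\<^sup>2 * H i j p"
    using mv[of i j] by blast
  obtain p' where p': "p' \<in> ball x R" "g (x + h *\<^sub>R axis j 1 + h *\<^sub>R axis i 1) - g (x + h *\<^sub>R axis j 1)
      - g (x + h *\<^sub>R axis i 1) + g x = h\<^sup>2 * H j i p'"
    using mv[of j i] by blast
  have swap: "x + h *\<^sub>R axis j 1 + h *\<^sub>R axis i 1 = x + h *\<^sub>R axis i 1 + h *\<^sub>R axis j 1"
    by (simp add: ac_simps)
  have "h\<^sup>2 * H i j p = h\<^sup>2 * H j i p'"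
    using p(2) p'(2) unfolding swap by linarith
  then have "H i j p = H j i p'" using h by simp
  moreover have "dist (H i j p) (H i j x) < e" "dist (H j i p') (H j i x) < e"
    using R(2) p(1) p'(1) by (auto simp: dist_commute)
  ultimately show False
    using dist_triangle_half_r[of "H i j p" "H i j x" "dist (H i j x) (H j i x)" "H j i x"]
    by (simp add: e_def)
qed

subsection \<open>Measure estimates\<close>

text \<open>The set lies in the interval from its infimum to its supremum, whose length is at most
  \<open>l\<close>.\<close>

lemma emeasure_le_of_diameter:
  fixes X :: "real set"
  assumes "X \<in> sets borel" "\<And>s t. \<lbrakk>s \<in> X; t \<in> X\<rbrakk> \<Longrightarrow> \<bar>s - t\<bar> \<le> l" "l \<ge> 0"
  shows "emeasure lborel X \<le> ennreal l"
proof (cases "X = {}")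
  case False
  then obtain s where s: "s \<in> X" by blast
  have "s - l \<le> t \<and> t \<le> s + l" if "t \<in> X" for t
    using assms(2)[OF s that] by linarith
  then have bdd: "bdd_below X" "bdd_above X"
    unfolding bdd_below_def bdd_above_def by blast+
  have "X \<subseteq> {Inf X..Sup X}" using bdd by (auto intro: cInf_lower cSup_upper)
  then have "emeasure lborel X \<le> emeasure lborel {Inf X..Sup X}" by (intro emeasure_mono) auto
  also have "\<dots> = ennreal (Sup X - Inf X)"
    using cInf_lower[OF s bdd(1)] cSup_upper[OF s bdd(2)] by (intro emeasure_lborel_Icc) linarith
  also have "\<dots> \<le> ennreal l"
  proof (rule ennreal_leI)
    have "Sup X \<le> t + l" if "t \<in> X" for t
      using False assms(2)[OF _ that] by (intro cSup_least) (auto simp: abs_le_iff algebra_simps)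
    then have "Sup X - l \<le> Inf X" using False by (intro cInf_greatest) (auto simp: algebra_simps)
    then show "Sup X - Inf X \<le> l" by simp
  qed
  finally show ?thesis .
qed simp

text \<open>Fubini in direction \<open>b\<close>: the other coordinates range over a cube of side
  \<open>2 * \<rho>\<close>, and each slice has diameter at most \<open>l\<close>.\<close>

lemma emeasure_le_of_slices:
  fixes A :: "'a::euclidean_space set"
  assumes A: "A \<in> sets borel" "A \<subseteq> ball x \<rho>" and b: "b \<in> Basis" and "l \<ge> 0"
    and slice: "\<And>y t. \<lbrakk>y \<in> A; y + t *\<^sub>R b \<in> A\<rbrakk> \<Longrightarrow> \<bar>t\<bar> \<le> l"
  shows "emeasure lborel A \<le> ennreal ((2 * \<rho>) ^ (DIM('a) - 1) * l)"
proof (cases "\<rho> > 0")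
  case True
  define J where "J = Basis - {b}"
  have J: "finite J" "b \<notin> J" "insert b J = Basis" "card J = DIM('a) - 1"
    using b by (auto simp: J_def)
  interpret product_sigma_finite "\<lambda>_::'a. lborel :: real measure" ..
  \<comment> \<open>\<open>T\<close> assembles a point from its coordinates; as \<open>t\<close>
    varies, \<open>T (f(b := t))\<close> runs through a line in direction \<open>b\<close>.\<close>
  define T :: "('a \<Rightarrow> real) \<Rightarrow> 'a" where "T = (\<lambda>f. \<Sum>b\<in>Basis. f b *\<^sub>R b)"
  have T: "T \<in> measurable (\<Pi>\<^sub>M b\<in>Basis. lborel) borel" unfolding T_def by measurable
  define box where "box = Pi\<^sub>E J (\<lambda>c. {x \<bullet> c - \<rho>..x \<bullet> c + \<rho>})"
  have ind: "(\<lambda>f. indicator A (T f) :: ennreal) \<in> borel_measurable (Pi\<^sub>M (insert b J) (\<lambda>_. lborel))"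
    using T A(1) unfolding J by measurable
  have T_upd: "T (f(b := t)) = T (f(b := s)) + (t - s) *\<^sub>R b" for f s t
  proof -
    have "(\<Sum>c\<in>J. (f(b := t)) c *\<^sub>R c) = (\<Sum>c\<in>J. (f(b := s)) c *\<^sub>R c)"
      using J(2) by (intro sum.cong) auto
    then show ?thesis
      unfolding T_def J(3)[symmetric] using J(1,2) by (simp add: algebra_simps)
  qed
  have T_comp: "T f \<bullet> c = f c" if "c \<in> Basis" for f c
    using that by (simp add: T_def)
  have inner_bound: "(\<integral>\<^sup>+t. indicator A (T (f(b := t))) \<partial>lborel) \<le> ennreal l * indicator box f"
    if f: "f \<in> space (Pi\<^sub>M J (\<lambda>_. lborel))" for f
  proof -
    let ?X = "{t. T (f(b := t)) \<in> A}"
    have meas: "(\<lambda>t. f(b := t)) \<in> measurable lborel (Pi\<^sub>M (insert b J) (\<lambda>_. lborel))"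
      using f J(2) by (auto intro!: measurable_fun_upd)
    have X: "?X \<in> sets borel"
    proof -
      have "(\<lambda>t. T (f(b := t))) \<in> measurable lborel borel"
        using measurable_comp[OF meas] T unfolding J comp_def by blast
      from measurable_sets[OF this A(1)] show ?thesis by (simp add: vimage_def)
    qed
    have "(\<integral>\<^sup>+t. indicator A (T (f(b := t))) \<partial>lborel) = (\<integral>\<^sup>+t. indicator ?X t \<partial>lborel)"
      by (intro nn_integral_cong) (auto simp: indicator_def)
    also have "\<dots> = emeasure lborel ?X" using X by simp
    also have "\<dots> \<le> ennreal l * indicator box f"
    proof (cases "?X = {}")
      case False
      then obtain t where "T (f(b := t)) \<in> A" by blast
      then have "dist (T (f(b := t))) x < \<rho>" using A(2) by (auto simp: dist_commute)
      then have near: "\<bar>(T (f(b := t)) - x) \<bullet> c\<bar> < \<rho>" if "c \<in> Basis" for c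
        using Basis_le_norm[OF that, of "T (f(b := t)) - x"] by (simp add: dist_norm)
      have "\<bar>f c - x \<bullet> c\<bar> < \<rho>" if "c \<in> J" for c
        using that near[of c] T_comp[of c "f(b := t)"] by (auto simp: inner_diff_left J_def)
      then have "f \<in> box"
        using f by (force simp: box_def space_PiM PiE_iff abs_less_iff)
      moreover have "emeasure lborel ?X \<le> ennreal l"
      proof (rule emeasure_le_of_diameter[OF X _ \<open>l \<ge> 0\<close>])
        fix s t assume "s \<in> ?X" "t \<in> ?X"
        then show "\<bar>s - t\<bar> \<le> l" using slice[of "T (f(b := t))" "s - t"] T_upd[of f s t] by simp
      qed
      ultimately show ?thesis by simp
    qed simp
    finally show ?thesis .
  qed
  have box: "box \<in> sets (Pi\<^sub>M J (\<lambda>_. lborel))"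
    unfolding box_def using J(1) by (intro sets_PiM_I_finite) auto
  \<comment> \<open>Lebesgue measure is the image under \<open>T\<close> of the product of the
    one-dimensional measures.\<close>
  have "emeasure lborel A = (\<integral>\<^sup>+f. indicator A (T f) \<partial>Pi\<^sub>M (insert b J) (\<lambda>_. lborel))"
    using A(1) T unfolding J(3)
    by (subst nn_integral_indicator[symmetric], simp, subst lborel_eq, subst nn_integral_distr) (auto simp: T_def)
  also have "\<dots> = (\<integral>\<^sup>+f. (\<integral>\<^sup>+t. indicator A (T (f(b := t))) \<partial>lborel) \<partial>Pi\<^sub>M J (\<lambda>_. lborel))"
    by (rule product_nn_integral_insert[OF J(1,2) ind])
  also have "\<dots> \<le> (\<integral>\<^sup>+f. ennreal l * indicator box f \<partial>Pi\<^sub>M J (\<lambda>_. lborel))"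
    by (intro nn_integral_mono inner_bound)
  also have "\<dots> = ennreal l * emeasure (Pi\<^sub>M J (\<lambda>_. lborel)) box"
    using box by (simp add: nn_integral_cmult_indicator)
  also have "\<dots> = ennreal l * (\<Prod>c\<in>J. ennreal (2 * \<rho>))"
    unfolding box_def using J(1) True by (subst emeasure_PiM) auto
  also have "\<dots> = ennreal ((2 * \<rho>) ^ (DIM('a) - 1) * l)"
    using True \<open>l \<ge> 0\<close> by (simp add: J ennreal_power ennreal_mult[symmetric] mult.commute)
  finally show ?thesis .
next
  case False
  then have "A = {}" using A(2) ball_empty[of \<rho> x] by auto
  then show ?thesis by simp
qed

text \<open>The nearest integer minimises the distance, so any integer within \<delta> will do. This
  removes \<open>round\<close>, which is discontinuous.\<close>

lemma dist_nearest_int_less_iff: "dist_nearest_int z < \<delta> \<longleftrightarrow> (\<exists>p::int. \<bar>z - p\<bar> < \<delta>)"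
  unfolding dist_nearest_int_def by (metis round_diff_minimal order.strict_trans1)

lemma open_dist_nearest_int_less:
  assumes "continuous_on U g" "open U"
  shows "open {x \<in> U. dist_nearest_int (g x) < \<delta>}"
proof -
  have "open (U \<inter> g -` ball (of_int p) \<delta>)" for p :: int
    using assms by (intro continuous_open_preimage) auto
  moreover have "{x \<in> U. dist_nearest_int (g x) < \<delta>} = (\<Union>p::int. U \<inter> g -` ball (of_int p) \<delta>)"
    by (auto simp: dist_nearest_int_less_iff dist_real_def abs_minus_commute)
  ultimately show ?thesis
    using open_UN[of UNIV "\<lambda>p::int. U \<inter> g -` ball (of_int p) \<delta>"] by simp
qed

section \<open>The local estimate on a small ball about a point of large gradient\<close>

context
  fixes g :: "real ^ 'd::finite \<Rightarrow> real" and D H x G \<rho> k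
  assumes part: "has_partials g D (ball x \<rho>)"
    and part2: "\<And>i. has_partials (D i) (H i) (ball x \<rho>)"
    and H: "\<And>i j y. y \<in> ball x \<rho> \<Longrightarrow> \<bar>H i j y\<bar> \<le> G\<^sup>2 / real CARD('d)"
    and G: "G > 0" and D: "\<And>i. \<bar>D i x\<bar> \<le> G" and Dk: "\<bar>D k x\<bar> = G"
    and \<rho>: "\<rho> = 1 / (8 * real CARD('d) * G)"
begin

text \<open>This is what the choice of \<rho> is for: the sum of the coordinates is at most the
  dimension times the norm, hence at most \<open>1 / (8 * G)\<close>.\<close>

lemma sum_abs_diff_le:
  assumes "y \<in> ball x \<rho>"
  shows "G * (\<Sum>i\<in>UNIV. \<bar>(y - x) $ i\<bar>) \<le> 1/8"
proof -
  have "G * (\<Sum>i\<in>UNIV. \<bar>(y - x) $ i\<bar>) \<le> G * (real CARD('d) * \<rho>)"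
    using assms G sum_abs_components_le[of "y - x"]
    by (intro mult_left_mono order.trans[OF sum_abs_components_le] mult_left_mono)
      (auto simp: dist_norm norm_minus_commute)
  also have "\<dots> = 1/8" using G by (simp add: \<rho>)
  finally show ?thesis .
qed

text \<open>The bound \<open>G\<^sup>2 / d\<close> on the second derivatives, integrated over
  coordinate steps of total length at most \<open>1 / (8 * G)\<close>, allows a change of at most
  \<open>G / 8\<close>.\<close>

lemma partials_close:
  assumes y: "y \<in> ball x \<rho>"
  shows "\<bar>D i y - D i x\<bar> \<le> G / 8"
proof -
  have "\<bar>D i (x + (y - x)) - D i x - (\<Sum>j\<in>UNIV. (y - x) $ j * 0)\<bar>
      \<le> G\<^sup>2 / real CARD('d) * (\<Sum>j\<in>UNIV. \<bar>(y - x) $ j\<bar>)"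
    using y H by (intro increment_bound[OF part2]) (auto simp: dist_norm norm_minus_commute)
  also have "\<dots> \<le> G\<^sup>2 * (\<Sum>j\<in>UNIV. \<bar>(y - x) $ j\<bar>)"
    using G by (intro mult_right_mono sum_nonneg) (auto simp: divide_le_eq)
  also have "\<dots> = G * (G * (\<Sum>j\<in>UNIV. \<bar>(y - x) $ j\<bar>))" by (simp add: power2_eq_square)
  also have "\<dots> \<le> G * (1/8)" using G sum_abs_diff_le[OF y] by (intro mult_left_mono) auto
  finally show ?thesis by simp
qed

text \<open>All partials are at most \<open>9/8 * G\<close> on the ball, so \<open>g\<close> changes
  by at most \<open>9/64\<close>.\<close>

lemma values_close:
  assumes y: "y \<in> ball x \<rho>"
  shows "\<bar>g y - g x\<bar> < 1/4"
proof -
  have "\<bar>D i z - 0\<bar> \<le> 9/8 * G" if "z \<in> ball x \<rho>" for i z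
    using partials_close[OF that, of i] D[of i] by linarith
  then have "\<bar>g (x + (y - x)) - g x - (\<Sum>j\<in>UNIV. (y - x) $ j * 0)\<bar>
      \<le> 9/8 * G * (\<Sum>j\<in>UNIV. \<bar>(y - x) $ j\<bar>)"
    using y by (intro increment_bound[OF part]) (auto simp: dist_norm norm_minus_commute)
  then show ?thesis using sum_abs_diff_le[OF y] by simp
qed

text \<open>Between the two points, \<open>D k\<close> stays within \<open>G / 8\<close> of a number
  of absolute value \<open>G\<close>; the segment remains in the ball by convexity.\<close>

lemma coordinate_growth:
  assumes y: "y \<in> ball x \<rho>" "y + t *\<^sub>R axis k 1 \<in> ball x \<rho>"
  shows "G * \<bar>t\<bar> \<le> 2 * \<bar>g (y + t *\<^sub>R axis k 1) - g y\<bar>"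
proof -
  have "y + s *\<^sub>R axis k 1 \<in> ball x \<rho>" if "s \<in> closed_segment 0 t" for s
  proof -
    obtain u where u: "s = u * t" "0 \<le> u" "u \<le> 1" using \<open>s \<in> closed_segment 0 t\<close>
      by (auto simp: in_segment)
    have "(1 - u) *\<^sub>R y + u *\<^sub>R (y + t *\<^sub>R axis k 1) \<in> ball x \<rho>"
      using u y by (intro convexD_alt[OF convex_ball]) auto
    then show ?thesis by (simp add: u(1) algebra_simps)
  qed
  then have "\<bar>g (y + t *\<^sub>R axis k 1) - g y - t * D k x\<bar> \<le> G / 8 * \<bar>t\<bar>"
    using partials_close by (intro coordinate_increment[OF part]) auto
  moreover have "\<bar>t * D k x\<bar> = G * \<bar>t\<bar>" using Dk by (simp add: abs_mult)
  moreover have "c \<le> 2 * \<bar>a\<bar>" if "\<bar>a - b\<bar> \<le> c / 8" "\<bar>b\<bar> = c" for a b c :: real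
    using that by linarith
  ultimately show ?thesis by simp
qed

text \<open>A single integer is involved on the whole ball, so \<open>coordinate_growth\<close>
  bounds the slices in direction \<open>k\<close> by \<open>4 * \<delta> / G\<close>. The slice
  estimate is then compared with the volume of the ball.\<close>

lemma measure_near_integer_le:
  assumes cont: "continuous_on (ball x \<rho>) g" and \<delta>: "0 < \<delta>" "\<delta> \<le> 1/4"
    and x: "dist_nearest_int (g x) < \<delta>"
  shows "measure lebesgue {y \<in> ball x \<rho>. dist_nearest_int (g y) < \<delta>}
    \<le> 2 ^ (CARD('d) + 4) * real CARD('d) / unit_ball_vol (real CARD('d)) * \<delta> * measure lebesgue (ball x \<rho>)"
    (is "measure lebesgue ?A \<le> ?\<kappa> * \<delta> * _")
proof -
  have \<rho>_pos: "\<rho> > 0" using G by (simp add: \<rho>)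
  have A: "?A \<in> sets borel" by (rule borel_open[OF open_dist_nearest_int_less[OF cont open_ball]])
  obtain p0 :: int where p0: "\<bar>g x - p0\<bar> < \<delta>" using x dist_nearest_int_less_iff by blast
  have same_int: "\<bar>g y - p0\<bar> < \<delta>" if "y \<in> ?A" for y
  proof -
    have "dist_nearest_int (g y) < \<delta>" and y: "y \<in> ball x \<rho>" using that by auto
    then obtain p :: int where p: "\<bar>g y - p\<bar> < \<delta>"
      unfolding dist_nearest_int_less_iff by blast
    have "\<bar>g y - g x\<bar> < 1/4" using values_close y by blast
    \<comment> \<open>Three errors of at most \<open>1/4\<close> each add up to less than 1.\<close>
    then have "\<bar>real_of_int p - real_of_int p0\<bar> < 1" using p p0 \<delta> by linarith
    then have "p = p0" by linarith
    with p show ?thesis by simp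
  qed
  have slice: "\<bar>t\<bar> \<le> 4 * \<delta> / G" if "y \<in> ?A" "y + t *\<^sub>R axis k 1 \<in> ?A" for y t
  proof -
    have "\<bar>g (y + t *\<^sub>R axis k 1) - g y\<bar> < 2 * \<delta>"
      using same_int[OF that(1)] same_int[OF that(2)] by linarith
    then have "2 * \<bar>g (y + t *\<^sub>R axis k 1) - g y\<bar> \<le> 4 * \<delta>" by simp
    with coordinate_growth[of y t] that have "G * \<bar>t\<bar> \<le> 4 * \<delta>"
      by (blast intro: order_trans)
    then show ?thesis using G by (simp add: field_simps)
  qed
  have "emeasure lborel ?A \<le> ennreal ((2 * \<rho>) ^ (DIM(real ^ 'd) - 1) * (4 * \<delta> / G))"
    using A G \<delta> slice by (intro emeasure_le_of_slices[where x = x and b = "axis k 1"]) (auto intro: axis_in_Basis_iff[THEN iffD2])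
  then have "measure lebesgue ?A \<le> (2 * \<rho>) ^ (CARD('d) - 1) * (4 * \<delta> / G)"
    using A G \<delta> \<rho>_pos by (simp add: measure_def enn2real_leI)
  also have "\<dots> = ?\<kappa> * \<delta> * (unit_ball_vol (real CARD('d)) * \<rho> ^ CARD('d))"
  proof -
    have V: "unit_ball_vol (real CARD('d)) \<noteq> 0"
      by (metis unit_ball_vol_pos less_irrefl of_nat_0_le_iff)
    \<comment> \<open>Solving the definition of \<rho> for \<open>1 / G\<close> supplies the missing
      factor \<open>2 * \<rho>\<close>, which completes the power to the full dimension.\<close>
    have "4 * \<delta> / G = (2 * \<rho>) * (16 * real CARD('d) * \<delta>)" using G by (simp add: \<rho>)
    then have "(2 * \<rho>) ^ (CARD('d) - 1) * (4 * \<delta> / G) =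
        (2 * \<rho>) ^ (CARD('d) - 1) * (2 * \<rho>) * (16 * real CARD('d) * \<delta>)"
      by (simp only: mult.assoc)
    also have "\<dots> = (2 * \<rho>) ^ CARD('d) * (16 * real CARD('d) * \<delta>)"
      by (simp only: power_minus_mult zero_less_card_finite)
    also have "\<dots> = ?\<kappa> * \<delta> * (unit_ball_vol (real CARD('d)) * \<rho> ^ CARD('d))"
      using V by (simp add: power_mult_distrib power_add)
    finally show ?thesis .
  qed
  also have "unit_ball_vol (real CARD('d)) * \<rho> ^ CARD('d) = measure lebesgue (ball x \<rho>)"
    using \<rho>_pos by (simp add: content_ball)
  finally show ?thesis .
qed

end

text \<open>The unit ball lies in a cube of side 2.\<close>

lemma unit_ball_vol_le: "unit_ball_vol (real DIM('a::euclidean_space)) \<le> 2 ^ DIM('a)"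
proof -
  have "unit_ball_vol (real DIM('a)) = measure lborel (ball (0::'a) 1)" by (simp add: content_ball)
  also have "\<dots> \<le> measure lborel (cbox (- One) (One :: 'a))"
  proof (rule measure_mono_fmeasurable)
    show "ball (0::'a) 1 \<subseteq> cbox (- One) One"
      by (auto simp: mem_box abs_le_iff dest!: order.strict_trans1[OF Basis_le_norm] intro: less_imp_le)
  qed auto
  also have "\<dots> = 2 ^ DIM('a)" by (subst content_cbox) auto
  finally show ?thesis .
qed

text \<open>The local bounds are summed over a subfamily that covers \<open>E\<close> with
  multiplicity at most \<open>N\<close>. Its balls lie in \<open>W\<close>, so their measures add up
  to at most \<open>N\<close> times that of \<open>W\<close>.\<close>

lemma measure_le_of_besicovitch:
  fixes E :: "'a::euclidean_space set"
  assumes N: "besicovitch_bound TYPE('a) N"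
    and E: "E \<in> lmeasurable" "bounded E" and W: "W \<in> lmeasurable" and "\<kappa> \<ge> 0"
    and \<rho>: "\<And>x. x \<in> E \<Longrightarrow> \<rho> x > 0" "\<And>x. x \<in> E \<Longrightarrow> ball x (\<rho> x) \<subseteq> W"
    and loc: "\<And>x. x \<in> E \<Longrightarrow> measure lebesgue (E \<inter> ball x (\<rho> x)) \<le> \<kappa> * measure lebesgue (ball x (\<rho> x))"
  shows "measure lebesgue E \<le> \<kappa> * (real N * measure lebesgue W)"
proof (cases "E = {}")
  case False
  define B where "B = (\<lambda>x. ball x (\<rho> x)) ` E"
  have "\<exists>C\<subseteq>B. countable C \<and> E \<subseteq> \<Union>C \<and> (\<forall>x. finite {A\<in>C. x \<in> A} \<and> card {A\<in>C. x \<in> A} \<le> N)"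
    using E(2) \<rho>(1) by (intro N[unfolded besicovitch_bound_def, rule_format]) (auto simp: B_def)
  then obtain C where C: "C \<subseteq> B" "countable C" "E \<subseteq> \<Union>C"
    and mult: "\<And>x. finite {A\<in>C. x \<in> A}" "\<And>x. card {A\<in>C. x \<in> A} \<le> N" by blast
  have "C \<noteq> {}" using C(3) False by auto
  have ball_sets: "A \<in> lmeasurable" "A \<subseteq> W" "measure lebesgue (E \<inter> A) \<le> \<kappa> * measure lebesgue A"
    if "A \<in> C" for A
    using that C(1) \<rho> loc by (auto simp: B_def)
  have int: "integrable lebesgue (indicat_real A)" if "A \<in> C" for A
    using ball_sets(1)[OF that] by (simp add: lmeasurable_iff_integrable)
  \<comment> \<open>The sum of the measures is the integral of the number of balls through a point,
    which is at most \<open>N\<close> and vanishes outside \<open>W\<close>.\<close>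
  have total: "(\<Sum>A\<in>F. measure lebesgue A) \<le> real N * measure lebesgue W" if F: "finite F" "F \<subseteq> C" for F
  proof -
    have "(\<Sum>A\<in>F. measure lebesgue A) = (\<Sum>A\<in>F. \<integral>x. indicator A x \<partial>lebesgue)"
      by simp
    also have "\<dots> = (\<integral>x. (\<Sum>A\<in>F. indicator A x) \<partial>lebesgue)"
      using F int by (intro Bochner_Integration.integral_sum[symmetric]) blast
    also have "\<dots> \<le> (\<integral>x. real N * indicator W x \<partial>lebesgue)"
    proof (rule integral_mono)
      show "integrable lebesgue (\<lambda>x. \<Sum>A\<in>F. indicator A x :: real)"
        using F int by (intro Bochner_Integration.integrable_sum) blast
      show "integrable lebesgue (\<lambda>x. real N * indicator W x)"
        using W by (simp add: lmeasurable_iff_integrable)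
      fix x
      have "(\<Sum>A\<in>F. indicator A x :: real) = real (card {A\<in>F. x \<in> A})"
        using F(1) by (simp add: indicator_def sum.If_cases Int_def)
      moreover have "card {A\<in>F. x \<in> A} \<le> card {A\<in>C. x \<in> A}"
        using F mult(1) by (intro card_mono) auto
      moreover have "{A\<in>F. x \<in> A} = {}" if "x \<notin> W" using F ball_sets(2) that by blast
      ultimately show "(\<Sum>A\<in>F. indicator A x) \<le> real N * indicator W x"
        using mult(2)[of x] by (cases "x \<in> W") auto
    qed
    also have "\<dots> = real N * measure lebesgue W" by simp
    finally show ?thesis .
  qed
  define A where "A = from_nat_into C"
  have A: "A i \<in> C" for i using \<open>C \<noteq> {}\<close> by (simp add: A_def from_nat_into)
  have "E = (\<Union>i. E \<inter> A i)"
    using C(3) range_from_nat_into[OF \<open>C \<noteq> {}\<close> C(2)] unfolding A_def by blast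
  moreover have "measure lebesgue (\<Union>i. E \<inter> A i) \<le> \<kappa> * (real N * measure lebesgue W)"
  proof (rule measure_countable_Union_le)
    show "E \<inter> A i \<in> lmeasurable" for i using E(1) ball_sets(1)[OF A] by (rule fmeasurable.Int)
    fix n
    \<comment> \<open>The enumeration repeats members when \<open>C\<close> is finite; summing over
      the set of balls counts each one once.\<close>
    have "(\<Union>i\<le>n. E \<inter> A i) = (\<Union>X\<in>A ` {..n}. E \<inter> X)" by simp
    also have "measure lebesgue \<dots> \<le> (\<Sum>X\<in>A ` {..n}. measure lebesgue (E \<inter> X))"
      using E(1) ball_sets(1) A by (intro measure_UNION_le) (auto intro: fmeasurableD)
    also have "\<dots> \<le> (\<Sum>X\<in>A ` {..n}. \<kappa> * measure lebesgue X)"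
      using A by (intro sum_mono ball_sets(3)) auto
    also have "\<dots> = \<kappa> * (\<Sum>X\<in>A ` {..n}. measure lebesgue X)" by (simp only: sum_distrib_left)
    also have "\<dots> \<le> \<kappa> * (real N * measure lebesgue W)"
      using A \<open>\<kappa> \<ge> 0\<close> by (intro mult_left_mono total) auto
    finally show "measure lebesgue (\<Union>i\<le>n. E \<inter> A i) \<le> \<kappa> * (real N * measure lebesgue W)" .
  qed
  ultimately show ?thesis by simp
qed (use \<open>\<kappa> \<ge> 0\<close> in simp)

subsection \<open>The large gradient estimate\<close>

lemma has_partials_inner:
  fixes f :: "real ^ 'd::finite \<Rightarrow> 'b::real_inner"
  assumes "\<And>i x. x \<in> S \<Longrightarrow> (\<lambda>t. f (x + t *\<^sub>R axis i 1)) differentiable (at 0)"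
  shows "has_partials (\<lambda>x. f x \<bullet> q) (\<lambda>i x. partial_deriv i f x \<bullet> q) S"
  unfolding has_partials_def
proof (intro allI ballI)
  fix i x assume "x \<in> S"
  then have "((\<lambda>t. f (x + t *\<^sub>R axis i 1)) has_vector_derivative partial_deriv i f x) (at 0)"
    using assms unfolding partial_deriv_def vector_derivative_works by blast
  then show "((\<lambda>t. f (x + t *\<^sub>R axis i 1) \<bullet> q) has_real_derivative partial_deriv i f x \<bullet> q) (at 0)"
    unfolding has_real_derivative_iff_has_vector_derivative
    by (rule bounded_linear.has_vector_derivative[OF bounded_linear_inner_left])
qed

text \<open>Each of the \<open>CARD('n)\<close> products is at most the product of the sup norms;
  this is the source of the factor \<open>n\<close> in the gradient threshold.\<close>

lemma abs_inner_le_infnorm: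
  fixes v q :: "real ^ 'n::finite"
  shows "\<bar>v \<bullet> q\<bar> \<le> real CARD('n) * infnorm v * infnorm q"
proof -
  have "\<bar>v \<bullet> q\<bar> \<le> (\<Sum>j\<in>UNIV. \<bar>v $ j * q $ j\<bar>)"
    unfolding inner_vec_def inner_real_def by (rule sum_abs)
  also have "\<dots> \<le> real CARD('n) * (infnorm v * infnorm q)"
    by (rule sum_bounded_above)
      (auto simp: abs_mult intro!: mult_mono component_le_infnorm_cart infnorm_pos_le)
  finally show ?thesis by (simp add: mult.assoc)
qed

lemma infnorm_attained:
  fixes v :: "real ^ 'n::finite"
  obtains k where "\<bar>v $ k\<bar> = infnorm v"
proof -
  have "infnorm v \<in> (\<lambda>b. \<bar>v \<bullet> b\<bar>) ` Basis"
    unfolding infnorm_Max by (rule Max_in) auto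
  then show ?thesis using that by (auto simp: Basis_vec_def inner_axis)
qed

text \<open>The enumeration of \<beta> picked by \<open>SOME\<close> is a permutation of
  \<open>[i, j]\<close>, but which one cannot be told; hence the disjunction.\<close>

lemma multi_partial_deriv_second:
  obtains \<beta> where "multi_index_order \<beta> = 2"
    "multi_partial_deriv \<beta> f = partial_deriv i (partial_deriv j f) \<or>
     multi_partial_deriv \<beta> f = partial_deriv j (partial_deriv i f)"
proof
  define \<beta> :: "nat ^ 'a" where "\<beta> = (\<chi> k. (if k = i then 1 else 0) + (if k = j then 1 else 0))"
  show "multi_index_order \<beta> = 2"
    by (simp add: multi_index_order_def \<beta>_def sum.distrib)
  define ks where "ks = (SOME is. \<forall>k. count_list is k = \<beta> $ k)"
  have "\<forall>k. count_list ks k = \<beta> $ k"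
    unfolding ks_def by (rule someI[of _ "[i, j]"]) (auto simp: \<beta>_def)
  then have "mset ks = mset [i, j]"
    by (intro multiset_eqI) (auto simp: count_mset \<beta>_def)
  moreover from this have "length ks = 2" using mset_eq_length by fastforce
  then obtain a b where ks: "ks = [a, b]" by (auto simp: numeral_2_eq_2 length_Suc_conv)
  ultimately have "ks = [i, j] \<or> ks = [j, i]" by (auto simp: add_eq_conv_ex)
  then show "multi_partial_deriv \<beta> f = partial_deriv i (partial_deriv j f) \<or>
     multi_partial_deriv \<beta> f = partial_deriv j (partial_deriv i f)"
    unfolding multi_partial_deriv_def ks_def[symmetric] by auto
qed

lemma infnorm_second_partials_le:
  assumes "second_deriv_sup f S \<le> ereal l" "x \<in> S"
  shows "infnorm (partial_deriv i (partial_deriv j f) x) \<le> l \<or>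
    infnorm (partial_deriv j (partial_deriv i f) x) \<le> l"
proof -
  obtain \<beta> where \<beta>: "multi_index_order \<beta> = 2"
    "multi_partial_deriv \<beta> f = partial_deriv i (partial_deriv j f) \<or>
     multi_partial_deriv \<beta> f = partial_deriv j (partial_deriv i f)"
    by (rule multi_partial_deriv_second)
  have "ereal (infnorm (multi_partial_deriv \<beta> f x)) \<le> second_deriv_sup f S"
    unfolding second_deriv_sup_def using \<beta>(1) assms(2) by (intro SUP_upper2[of \<beta>] SUP_upper) auto
  with assms(1) have "infnorm (multi_partial_deriv \<beta> f x) \<le> l"
    by (metis ereal_less_eq(3) order_trans)
  with \<beta>(2) show ?thesis by auto
qed

text \<open>The left-hand side is the constant that the covering argument produces. For
  \<open>d \<ge> 2\<close> the exponent \<open>d / 2\<close> is at least 1, for \<open>d = 1\<close>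
  both powers of \<open>d\<close> are 1, and \<open>d + 2 \<le> 2 * d + 1\<close> always.\<close>

lemma K_const_ge: "4 ^ (CARD('d) + 2) * real CARD('d) / unit_ball_vol (real CARD('d))
    * real (besicovitch_const TYPE(real ^ 'd)) \<le> K_const TYPE('d::finite)"
proof -
  have d: "CARD('d) \<ge> 1" by (simp add: Suc_leI)
  have "real CARD('d) \<le> real CARD('d) powr (real CARD('d) / 2)"
  proof (cases "CARD('d) = 1")
    case False
    then have "real CARD('d) powr 1 \<le> real CARD('d) powr (real CARD('d) / 2)"
      using d by (intro powr_mono) linarith+
    then show ?thesis by simp
  qed simp
  moreover have "(4::real) ^ (CARD('d) + 2) \<le> 4 ^ (2 * CARD('d) + 1)"
    using d by (intro power_increasing) auto
  ultimately have "4 ^ (CARD('d) + 2) * real CARD('d) * (real (besicovitch_const TYPE(real ^ 'd)) / unit_ball_vol (real CARD('d)))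
    \<le> 4 ^ (2 * CARD('d) + 1) * real CARD('d) powr (real CARD('d) / 2)
      * (real (besicovitch_const TYPE(real ^ 'd)) / unit_ball_vol (real CARD('d)))"
    by (intro mult_right_mono mult_mono) auto
  then show ?thesis by (simp add: K_const_def)
qed

text \<open>Makes the claim trivial for \<delta> above \<open>1/4\<close>. It follows from the bound
  \<open>2 ^ d\<close> on the volume of the unit ball and the positivity of the Besicovitch
  constant.\<close>

lemma K_const_ge_4: "4 \<le> K_const TYPE('d::finite)"
proof -
  have V: "unit_ball_vol (real CARD('d)) \<le> 2 ^ CARD('d)" "unit_ball_vol (real CARD('d)) > 0"
    using unit_ball_vol_le[where 'a = "real ^ 'd"] by auto
  have N: "1 \<le> real (besicovitch_const TYPE(real ^ 'd))"
    using besicovitch_const_pos[where 'a = "real ^ 'd"] by linarith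
  have d: "1 \<le> real CARD('d)" by (simp add: Suc_leI)
  have "(2::real) ^ CARD('d) \<le> 4 ^ CARD('d)" by (intro power_mono) auto
  then have "unit_ball_vol (real CARD('d)) \<le> 4 ^ CARD('d)"
    using V(1) by (rule order_trans[rotated])
  moreover have "(0::real) \<le> 4 ^ CARD('d)" by simp
  ultimately have "4 * unit_ball_vol (real CARD('d)) \<le> 16 * 4 ^ CARD('d)" by linarith
  also have "\<dots> = 4 ^ (CARD('d) + 2) * 1 * 1" by (simp add: power_add)
  also have "\<dots> \<le> 4 ^ (CARD('d) + 2) * real CARD('d) * real (besicovitch_const TYPE(real ^ 'd))"
    using N d by (intro mult_mono) auto
  finally have "4 \<le> 4 ^ (CARD('d) + 2) * real CARD('d) / unit_ball_vol (real CARD('d))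
    * real (besicovitch_const TYPE(real ^ 'd))"
    using V(2) by (simp add: field_simps)
  also note K_const_ge
  finally show ?thesis .
qed

theorem theorem4:
  fixes f :: "real ^ 'd::finite \<Rightarrow> real ^ 'n::finite"
    and c :: "real ^ 'd" and r :: real
    and \<delta> :: real and q :: "real ^ 'n"
  assumes "r > 0"
    and "Ck_on 2 f (ball c (2 * r))"
    and "\<delta> > 0"
    and "\<forall>j. q $ j \<in> \<int>" and "q \<noteq> 0"
  defines "E \<equiv> {x \<in> ball c r.
      dist_nearest_int (f x \<bullet> q) < \<delta> \<and>
      ereal (infnorm (gradient (\<lambda>y. f y \<bullet> q) x)) \<ge>
        ereal_sqrt (ereal (real CARD('n)) * ereal (real CARD('d)) * L_bound f c r * ereal (infnorm q))}"
  shows "E \<in> lmeasurable \<and>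
    measure lebesgue E \<le> K_const TYPE('d) * \<delta> * measure lebesgue (ball c r)"
proof -
  define S where "S = ball c (2 * r)"
  define g where "g = (\<lambda>x. f x \<bullet> q)"
  define D where "D = (\<lambda>i x. partial_deriv i f x \<bullet> q)"
  define H where "H = (\<lambda>i j x. partial_deriv j (partial_deriv i f) x \<bullet> q)"
  note Ck = assms(2)[folded S_def, unfolded numeral_2_eq_2 Ck_on.simps]
  have S: "open S" "ball c r \<subseteq> S" using \<open>r > 0\<close> by (auto simp: S_def)
  have part: "has_partials g D S"
    unfolding g_def D_def using Ck by (intro has_partials_inner) blast
  have part2: "has_partials (D i) (H i) S" for i
    unfolding D_def H_def using Ck by (intro has_partials_inner) blast
  have cont_g: "continuous_on S g"
    unfolding g_def using Ck by (intro continuous_intros) blast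
  have cont_D: "continuous_on S (D i)" for i
    unfolding D_def using Ck by (intro continuous_intros) blast
  have cont_H: "continuous_on S (H i j)" for i j
    unfolding H_def using Ck by (intro continuous_intros) blast
  have grad: "gradient g x = (\<chi> i. D i x)" if "x \<in> S" for x
    using continuous_partials_imp_GDERIV[OF S(1) that part cont_D] by (rule gradient_eq)
  have sym: "H i j x = H j i x" if "x \<in> S" for i j x
    by (rule mixed_partials_symmetric[OF S(1) that part part2 cont_H])

  obtain j0 where "q $ j0 \<noteq> 0" using \<open>q \<noteq> 0\<close> by (auto simp: vec_eq_iff)
  then have "1 \<le> \<bar>q $ j0\<bar>" using assms(4) Ints_nonzero_abs_ge1 by blast
  then have Q: "1 \<le> infnorm q" using component_le_infnorm_cart[of q j0] by linarith
  have n: "1 \<le> real CARD('n)" and d: "1 \<le> real CARD('d)" by (simp_all add: Suc_leI)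
  have L_ge: "ereal (1 / (4 * r\<^sup>2)) \<le> L_bound f c r" by (simp add: L_bound_def)

  show ?thesis
  proof (cases "L_bound f c r")
    case PInf
    \<comment> \<open>The threshold is infinite, whereas every gradient has finite norm.\<close>
    then have "E = {}" using Q n d by (auto simp: E_def ereal_sqrt_def)
    then show ?thesis using K_const_ge_4[where 'd = 'd] \<open>\<delta> > 0\<close> by simp
  next
    case MInf
    with L_ge show ?thesis by simp
  next
    case (real l)
    have l: "1 / (4 * r\<^sup>2) \<le> l" using L_ge by (simp add: real)
    have "second_deriv_sup f S \<le> L_bound f c r" by (simp add: L_bound_def S_def)
    then have sup: "second_deriv_sup f S \<le> ereal l" by (simp add: real)
    define b where "b = sqrt (real CARD('n) * real CARD('d) * l * infnorm q)"
    have E: "E = {x \<in> ball c r. dist_nearest_int (g x) < \<delta> \<and> b \<le> infnorm (\<chi> i. D i x)}"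
      unfolding E_def using S(2) grad by (auto simp: real ereal_sqrt_def b_def g_def)
    have "l > 0" using l \<open>r > 0\<close> by (smt (verit) divide_pos_pos zero_less_power)
    have H_le: "\<bar>H i j x\<bar> \<le> real CARD('n) * l * infnorm q" if "x \<in> S" for i j x
    proof -
      have *: "\<bar>H i j x\<bar> \<le> real CARD('n) * l * infnorm q"
        if "infnorm (partial_deriv j (partial_deriv i f) x) \<le> l" for i j
      proof -
        have "\<bar>H i j x\<bar> \<le> real CARD('n) * infnorm (partial_deriv j (partial_deriv i f) x) * infnorm q"
          unfolding H_def by (rule abs_inner_le_infnorm)
        also have "\<dots> \<le> real CARD('n) * l * infnorm q"
          using that by (intro mult_right_mono mult_left_mono infnorm_pos_le) auto
        finally show ?thesis .
      qed
      \<comment> \<open>The supremum controls one of the two orders of differentiation; symmetry of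
        \<open>H\<close> transfers the bound to the other.\<close>
      show ?thesis
        using infnorm_second_partials_le[OF sup \<open>x \<in> S\<close>, of j i] *[of i j] *[of j i] sym[OF \<open>x \<in> S\<close>, of i j]
        by auto
    qed
    have E_meas: "E \<in> lmeasurable"
    proof (rule bounded_set_imp_lmeasurable)
      show "bounded E" by (rule bounded_subset[of "ball c r"]) (auto simp: E)
      \<comment> \<open>The gradient condition cuts out a relatively closed subset of the ball, the
        integer condition an open one, so \<open>E\<close> is a Borel set.\<close>
      have "continuous_on (ball c r) (\<lambda>x. infnorm (\<chi> i. D i x))"
        using cont_D S(2) by (intro continuous_intros) (blast intro: continuous_on_subset)
      then have "closedin (top_of_set (ball c r)) (ball c r \<inter> (\<lambda>x. infnorm (\<chi> i. D i x)) -` {b..})"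
        by (rule continuous_closedin_preimage) simp
      then obtain T where "closed T" "ball c r \<inter> (\<lambda>x. infnorm (\<chi> i. D i x)) -` {b..} = ball c r \<inter> T"
        by (auto simp: closedin_closed)
      then have "ball c r \<inter> (\<lambda>x. infnorm (\<chi> i. D i x)) -` {b..} \<in> sets borel" by simp
      moreover have "ball c r \<inter> (\<lambda>x. infnorm (\<chi> i. D i x)) -` {b..} =
          {x \<in> ball c r. b \<le> infnorm (\<chi> i. D i x)}" by auto
      ultimately have "{x \<in> ball c r. b \<le> infnorm (\<chi> i. D i x)} \<in> sets borel" by simp
      moreover have "{x \<in> ball c r. dist_nearest_int (g x) < \<delta>} \<in> sets borel"
        using cont_g S(2) by (intro borel_open open_dist_nearest_int_less) (auto intro: continuous_on_subset)
      ultimately have "{x \<in> ball c r. b \<le> infnorm (\<chi> i. D i x)} \<inter> {x \<in> ball c r. dist_nearest_int (g x) < \<delta>} \<in> sets borel"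
        by (rule sets.Int)
      moreover have "{x \<in> ball c r. b \<le> infnorm (\<chi> i. D i x)} \<inter> {x \<in> ball c r. dist_nearest_int (g x) < \<delta>} = E"
        by (auto simp: E)
      ultimately show "E \<in> sets lebesgue" by simp
    qed
    moreover have "measure lebesgue E \<le> K_const TYPE('d) * \<delta> * measure lebesgue (ball c r)"
    proof (cases "\<delta> \<le> 1/4")
      case False
      \<comment> \<open>For large \<delta> the right-hand side is at least the measure of the whole
        ball.\<close>
      have "4 * (1/4) \<le> K_const TYPE('d) * \<delta>"
        using K_const_ge_4[where 'd = 'd] False by (intro mult_mono) linarith+
      then have "1 * measure lebesgue (ball c r) \<le> K_const TYPE('d) * \<delta> * measure lebesgue (ball c r)"
        by (intro mult_right_mono) auto
      moreover have "measure lebesgue E \<le> measure lebesgue (ball c r)"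
        using E_meas by (intro measure_mono_fmeasurable) (auto simp: E intro: fmeasurableD)
      ultimately show ?thesis by simp
    next
      case True
      define G where "G x = infnorm (\<chi> i. D i x)" for x
      define \<rho> where "\<rho> x = 1 / (8 * real CARD('d) * G x)" for x
      have G_sq: "real CARD('n) * real CARD('d) * l * infnorm q \<le> (G x)\<^sup>2" if "x \<in> E" for x
      proof -
        have "b \<le> G x" using that by (simp add: E G_def)
        moreover have "0 \<le> real CARD('n) * real CARD('d) * l * infnorm q"
          using \<open>l > 0\<close> by (simp add: infnorm_pos_le)
        ultimately show ?thesis
          unfolding b_def by (metis real_sqrt_ge_0_iff power_mono real_sqrt_pow2)
      qed
      \<comment> \<open>The lower bound \<open>1 / (4 * r\<^sup>2)\<close> built into
        \<open>L\<close> enters here, together with the sup norm of the nonzero integer vector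
        \<open>q\<close> being at least 1. It keeps the radii \<open>\<rho> x\<close> below
        \<open>r\<close>.\<close>
      have G_ge: "1 / (2 * r) \<le> G x" if "x \<in> E" for x
      proof (rule power2_le_imp_le)
        have "1 * 1 * l * 1 \<le> real CARD('n) * real CARD('d) * l * infnorm q"
          using n d Q \<open>l > 0\<close> by (intro mult_mono) auto
        then show "(1 / (2 * r))\<^sup>2 \<le> (G x)\<^sup>2"
          using l G_sq[OF that] by (simp add: power_divide power_mult_distrib)
      qed (simp add: G_def infnorm_pos_le)
      have G_pos: "G x > 0" if "x \<in> E" for x
        using G_ge[OF that] \<open>r > 0\<close> by (smt (verit) divide_pos_pos)
      have \<rho>_pos: "\<rho> x > 0" if "x \<in> E" for x using G_pos[OF that] by (simp add: \<rho>_def)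
      have \<rho>_le: "\<rho> x \<le> r" if "x \<in> E" for x
      proof -
        have "1 * G x \<le> real CARD('d) * G x"
          using d G_pos[OF that] by (intro mult_right_mono) auto
        moreover have "1 \<le> G x * (2 * r)"
          using G_ge[OF that] \<open>r > 0\<close> by (simp add: field_simps)
        then have "1 \<le> r * (8 * G x)" using G_pos[OF that] \<open>r > 0\<close> by (simp add: mult_ac)
        ultimately have "1 \<le> r * (8 * (real CARD('d) * G x))"
          using \<open>r > 0\<close> by (smt (verit) mult_left_mono)
        then show ?thesis using d G_pos[OF that] by (simp add: \<rho>_def field_simps)
      qed
      \<comment> \<open>The local balls stay inside the doubled ball, where the second derivatives
        are controlled.\<close>
      have sub: "ball x (\<rho> x) \<subseteq> S" if "x \<in> E" for x
      proof
        fix y assume "y \<in> ball x (\<rho> x)"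
        moreover have "x \<in> ball c r" using that by (simp add: E)
        ultimately show "y \<in> S"
          using \<rho>_le[OF that] dist_triangle[of c y x] by (simp add: S_def)
      qed
      define \<kappa> where "\<kappa> = 2 ^ (CARD('d) + 4) * real CARD('d) / unit_ball_vol (real CARD('d)) * \<delta>"
      have "\<kappa> \<ge> 0" using \<open>\<delta> > 0\<close> by (simp add: \<kappa>_def)
      have loc: "measure lebesgue (E \<inter> ball x (\<rho> x)) \<le> \<kappa> * measure lebesgue (ball x (\<rho> x))"
        if x: "x \<in> E" for x
      proof -
        obtain k where k: "\<bar>(\<chi> i. D i x) $ k\<bar> = G x" unfolding G_def by (rule infnorm_attained)
        have cont: "continuous_on (ball x (\<rho> x)) g" by (rule continuous_on_subset[OF cont_g sub[OF x]])
        have "measure lebesgue (E \<inter> ball x (\<rho> x)) \<le>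
            measure lebesgue {y \<in> ball x (\<rho> x). dist_nearest_int (g y) < \<delta>}"
        proof (rule measure_mono_fmeasurable)
          show "{y \<in> ball x (\<rho> x). dist_nearest_int (g y) < \<delta>} \<in> lmeasurable"
            using open_dist_nearest_int_less[OF cont open_ball]
            by (intro bounded_set_imp_lmeasurable bounded_subset[OF bounded_ball]) auto
        qed (use E_meas in \<open>auto simp: E intro: fmeasurableD\<close>)
        also have "\<dots> \<le> \<kappa> * measure lebesgue (ball x (\<rho> x))"
          unfolding \<kappa>_def
        proof (rule measure_near_integer_le[where D = D and H = H and G = "G x" and k = k])
          \<comment> \<open>The threshold squared is \<open>d\<close> times the bound on the second
            derivatives of \<open>g\<close>.\<close>
          show "\<bar>H i j y\<bar> \<le> (G x)\<^sup>2 / real CARD('d)" if "y \<in> ball x (\<rho> x)" for i j y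
          proof -
            have "\<bar>H i j y\<bar> \<le> real CARD('n) * l * infnorm q" using sub[OF x] that by (intro H_le) auto
            also have "\<dots> \<le> (G x)\<^sup>2 / real CARD('d)"
              using G_sq[OF x] d by (simp add: field_simps)
            finally show ?thesis .
          qed
          show "\<bar>D i x\<bar> \<le> G x" for i
            using component_le_infnorm_cart[of "\<chi> i. D i x" i] by (simp add: G_def)
          show "dist_nearest_int (g x) < \<delta>" using x by (simp add: E)
        qed (use k G_pos[OF x] cont True \<open>\<delta> > 0\<close> sub[OF x] part part2 in \<open>auto simp: \<rho>_def intro: has_partials_subset\<close>)
        finally show ?thesis .
      qed
      \<comment> \<open>The enclosing set is the doubled ball \<open>S\<close>, which costs a factor
        \<open>2 ^ d\<close>.\<close>
      have "measure lebesgue E \<le> \<kappa> * (real (besicovitch_const TYPE(real ^ 'd)) * measure lebesgue S)"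
        using E_meas \<rho>_pos sub loc \<open>\<kappa> \<ge> 0\<close>
        by (intro measure_le_of_besicovitch[OF besicovitch_bound_const, where \<rho> = \<rho>])
          (auto simp: S_def E intro: bounded_subset[OF bounded_ball])
      also have "measure lebesgue S = 2 ^ CARD('d) * measure lebesgue (ball c r)"
        using \<open>r > 0\<close> by (simp add: S_def content_ball power_mult_distrib)
      \<comment> \<open>The powers of two combine:
        \<open>2 ^ (d + 4) * 2 ^ d = 4 ^ (d + 2)\<close>.\<close>
      also have "\<kappa> * (real (besicovitch_const TYPE(real ^ 'd)) * (2 ^ CARD('d) * measure lebesgue (ball c r))) =
          4 ^ (CARD('d) + 2) * real CARD('d) / unit_ball_vol (real CARD('d))
            * real (besicovitch_const TYPE(real ^ 'd)) * (\<delta> * measure lebesgue (ball c r))"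
        using power_mult_distrib[of "2::real" 2 "CARD('d)"] by (simp add: \<kappa>_def power_add)
      also have "\<dots> \<le> K_const TYPE('d) * (\<delta> * measure lebesgue (ball c r))"
        using \<open>\<delta> > 0\<close> by (intro mult_right_mono K_const_ge) auto
      finally show ?thesis by (simp add: mult.assoc)
    qed
    ultimately show ?thesis ..
  qed
qed

end
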